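(* Let $E,F$ be operator spaces and let $\lambda=(\lambda_n:M_n\to M_n)_{n\in\mathbb{N}}$ be a uniformly bounded sequence of non-zero linear maps. Then $\mathcal{CB}_\lambda(E,F)$ is an operator space with the matrix norms obtained from the identification $M_n(\mathcal{CB}_\lambda(E,F))=\mathcal{CB}_\lambda(E,M_n(F))$, $n\in\mathbb{N}$, in which $[\phi_{ij}]$ corresponds to the map $e\mapsto[\phi_{ij}(e)]$.
   Context: $M_n$ is the C$^*$-algebra of $n\times n$ complex matrices; $M_n(E)=E\otimes_{min}M_n$ is the space of $n\times n$ matrices over the operator space $E$ with its matrix norm, and $\otimes_{min}$ is the minimal (spatial) operator space tensor product on the algebraic tensor product. A linear map $\phi:E\to F$ between operator spaces is $\lambda$-cb if $\|\phi\|_{cb}^\lambda:=\sup_{n}\|\phi\otimes\lambda_n\|<\infty$, where $\phi\otimes\lambda_n:E\otimes_{min}M_n\to F\otimes_{min}M_n$. $\mathcal{CB}_\lambda(E,F)$ denotes the space of all $\lambda$-cb maps from $E$ to $F$, normed by $\|\cdot\|_{cb}^\lambda$. An (abstract) operator space is a vector space $V$ with norms $\|\cdot\|_n$ on $M_n(V)$, $n\in\mathbb{N}$, satisfying Ruan's axioms: (R1) $\|v_1\oplus v_2\|_{n+m}\le\max\{\|v_1\|_n,\|v_2\|_m\}$ for $v_1\in M_n(V)$, $v_2\in M_m(V)$; (R2) $\|\alpha v\beta\|_m\le\|\alpha\|\|v\|_n\|\beta\|$ for $v\in M_n(V)$ and scalar matrices $\alpha\in M_{m\times n}$, $\beta\in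 M_{n\times m}$. *)

theory Defs
  imports "HOL-Analysis.Analysis" "HOL-Library.Function_Algebras"
begin

text \<open>
  Matrices are functions \<open>nat \<Rightarrow> nat \<Rightarrow> 'v\<close>, indexed from 0 and equal to 0 outside their format.
  Addition of matrices and of maps is the pointwise one of \<^theory>\<open>HOL-Library.Function_Algebras\<close>.
  Matrix sizes range over the positive integers.
\<close>

definition mats :: "'v::zero set \<Rightarrow> nat \<Rightarrow> nat \<Rightarrow> (nat \<Rightarrow> nat \<Rightarrow> 'v) set" where
  "mats S m n = {A. (\<forall>i<m. \<forall>j<n. A i j \<in> S) \<and> (\<forall>i j. i \<ge> m \<or> j \<ge> n \<longrightarrow> A i j = 0)}"

definition mat_unit :: "nat \<Rightarrow> nat \<Rightarrow> nat \<Rightarrow> nat \<Rightarrow> complex" where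
  "mat_unit k l = (\<lambda>i j. if i = k \<and> j = l then 1 else 0)"

definition op_norm :: "'a set \<Rightarrow> ('a \<Rightarrow> real) \<Rightarrow> ('b \<Rightarrow> real) \<Rightarrow> ('a \<Rightarrow> 'b) \<Rightarrow> ennreal" where
  "op_norm X p q T = (SUP x\<in>{x\<in>X. p x \<le> 1}. ennreal (q (T x)))"

definition l2norm :: "nat \<Rightarrow> (nat \<Rightarrow> complex) \<Rightarrow> real" where
  "l2norm n \<xi> = L2_set (\<lambda>i. cmod (\<xi> i)) {..<n}"

text \<open>The norm of an \<open>m \<times> n\<close> matrix as an operator between Hilbert spaces \<open>\<ell>\<^sup>2\<^sub>n \<rightarrow> \<ell>\<^sup>2\<^sub>m\<close>;
  coordinates of \<open>\<xi>\<close> beyond \<open>n\<close> play no role. For \<open>m = n\<close> it is the C*-norm.\<close>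

definition cmat_norm :: "nat \<Rightarrow> nat \<Rightarrow> (nat \<Rightarrow> nat \<Rightarrow> complex) \<Rightarrow> real" where
  "cmat_norm m n \<alpha> = enn2real (op_norm UNIV (l2norm n) (l2norm m) (\<lambda>\<xi> i. \<Sum>j<n. \<alpha> i j * \<xi> j))"

text \<open>A vector space (a linear subspace \<open>os_carrier\<close> of an ambient complex vector space)
  together with a function \<open>os_norm n\<close> on its \<open>n \<times> n\<close> matrices, for each \<open>n \<ge> 1\<close>.\<close>

record 'v os =
  os_carrier :: "'v set"
  os_scale :: "complex \<Rightarrow> 'v \<Rightarrow> 'v"
  os_norm :: "nat \<Rightarrow> (nat \<Rightarrow> nat \<Rightarrow> 'v) \<Rightarrow> real"

definition mat_dsum :: "nat \<Rightarrow> (nat \<Rightarrow> nat \<Rightarrow> 'v::zero) \<Rightarrow> (nat \<Rightarrow> nat \<Rightarrow> 'v) \<Rightarrow> nat \<Rightarrow> nat \<Rightarrow> 'v" where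
  "mat_dsum n v w = (\<lambda>i j. if i < n \<and> j < n then v i j
                           else if n \<le> i \<and> n \<le> j then w (i - n) (j - n) else 0)"

definition mat_sandwich :: "(complex \<Rightarrow> 'v \<Rightarrow> 'v) \<Rightarrow> nat \<Rightarrow> (nat \<Rightarrow> nat \<Rightarrow> complex) \<Rightarrow>
    (nat \<Rightarrow> nat \<Rightarrow> 'v::comm_monoid_add) \<Rightarrow> (nat \<Rightarrow> nat \<Rightarrow> complex) \<Rightarrow> nat \<Rightarrow> nat \<Rightarrow> 'v" where
  "mat_sandwich s n \<alpha> v \<beta> = (\<lambda>i j. \<Sum>k<n. \<Sum>l<n. s (\<alpha> i k * \<beta> l j) (v k l))"

locale operator_space = vector_space "os_scale V" for V :: "'v::ab_group_add os" +
  assumes carrier_subspace: "subspace (os_carrier V)"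
    and norm_nonneg: "\<And>n v. \<lbrakk>n \<ge> 1; v \<in> mats (os_carrier V) n n\<rbrakk> \<Longrightarrow> os_norm V n v \<ge> 0"
    and norm_eq_0: "\<And>n v. \<lbrakk>n \<ge> 1; v \<in> mats (os_carrier V) n n\<rbrakk> \<Longrightarrow> os_norm V n v = 0 \<longleftrightarrow> v = 0"
    and norm_scale: "\<And>n v c. \<lbrakk>n \<ge> 1; v \<in> mats (os_carrier V) n n\<rbrakk> \<Longrightarrow>
          os_norm V n (\<lambda>i j. os_scale V c (v i j)) = cmod c * os_norm V n v"
    and norm_add: "\<And>n v w. \<lbrakk>n \<ge> 1; v \<in> mats (os_carrier V) n n; w \<in> mats (os_carrier V) n n\<rbrakk> \<Longrightarrow>
          os_norm V n (v + w) \<le> os_norm V n v + os_norm V n w"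
    and ruan_R1: "\<And>n m v w. \<lbrakk>n \<ge> 1; m \<ge> 1; v \<in> mats (os_carrier V) n n; w \<in> mats (os_carrier V) m m\<rbrakk> \<Longrightarrow>
          os_norm V (n + m) (mat_dsum n v w) \<le> max (os_norm V n v) (os_norm V m w)"
    and ruan_R2: "\<And>n m \<alpha> v \<beta>. \<lbrakk>n \<ge> 1; m \<ge> 1; v \<in> mats (os_carrier V) n n;
            \<alpha> \<in> mats UNIV m n; \<beta> \<in> mats UNIV n m\<rbrakk> \<Longrightarrow>
          os_norm V m (mat_sandwich (os_scale V) n \<alpha> v \<beta>)
            \<le> cmat_norm m n \<alpha> * os_norm V n v * cmat_norm n m \<beta>"

definition complex_os :: "complex os" where
  "complex_os = \<lparr>os_carrier = UNIV, os_scale = (*), os_norm = (\<lambda>n. cmat_norm n n)\<rparr>"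

text \<open>\<open>M\<^sub>n(V)\<close> as an operator space, with \<open>M\<^sub>k(M\<^sub>n(V)) = M\<^sub>k\<^sub>n(V)\<close>: a matrix of matrices is
  read as a block matrix by deleting the inner brackets.\<close>

definition mat_flatten :: "nat \<Rightarrow> (nat \<Rightarrow> nat \<Rightarrow> nat \<Rightarrow> nat \<Rightarrow> 'v) \<Rightarrow> nat \<Rightarrow> nat \<Rightarrow> 'v" where
  "mat_flatten n A = (\<lambda>i j. A (i div n) (j div n) (i mod n) (j mod n))"

definition mat_os :: "nat \<Rightarrow> 'v::zero os \<Rightarrow> (nat \<Rightarrow> nat \<Rightarrow> 'v) os" where
  "mat_os n V = \<lparr>os_carrier = mats (os_carrier V) n n,
                 os_scale = (\<lambda>c v i j. os_scale V c (v i j)),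
                 os_norm = (\<lambda>k A. os_norm V (k * n) (mat_flatten n A))\<rparr>"

definition linear_map :: "'v::plus os \<Rightarrow> 'w::plus os \<Rightarrow> ('v \<Rightarrow> 'w) \<Rightarrow> bool" where
  "linear_map V W f \<longleftrightarrow>
     (\<forall>x\<in>os_carrier V. f x \<in> os_carrier W) \<and>
     (\<forall>x\<in>os_carrier V. \<forall>y\<in>os_carrier V. f (x + y) = f x + f y) \<and>
     (\<forall>c. \<forall>x\<in>os_carrier V. f (os_scale V c x) = os_scale W c (f x))"

text \<open>The map \<open>\<phi> \<otimes> \<lambda>\<^sub>n : M\<^sub>n(E) \<rightarrow> M\<^sub>n(F)\<close>. Under \<open>M\<^sub>n(E) = E \<otimes> M\<^sub>n\<close> a matrix \<open>x\<close> is
  \<open>\<Sum>\<^sub>k\<^sub>l x\<^sub>k\<^sub>l \<otimes> e\<^sub>k\<^sub>l\<close>, with image \<open>\<Sum>\<^sub>k\<^sub>l \<phi>(x\<^sub>k\<^sub>l) \<otimes> \<lambda>\<^sub>n(e\<^sub>k\<^sub>l)\<close>, whose \<open>(i,j)\<close> entry is the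
  sum below. The first argument is the scalar multiplication of \<open>F\<close>.\<close>

definition tensor_map :: "(complex \<Rightarrow> 'f \<Rightarrow> 'f) \<Rightarrow> nat \<Rightarrow> ('e \<Rightarrow> 'f::comm_monoid_add) \<Rightarrow>
    ((nat \<Rightarrow> nat \<Rightarrow> complex) \<Rightarrow> nat \<Rightarrow> nat \<Rightarrow> complex) \<Rightarrow> (nat \<Rightarrow> nat \<Rightarrow> 'e) \<Rightarrow> nat \<Rightarrow> nat \<Rightarrow> 'f" where
  "tensor_map s n \<phi> \<Lambda> x = (\<lambda>i j. \<Sum>k<n. \<Sum>l<n. s (\<Lambda> (mat_unit k l) i j) (\<phi> (x k l)))"

type_synonym cmat_maps = "nat \<Rightarrow> (nat \<Rightarrow> nat \<Rightarrow> complex) \<Rightarrow> nat \<Rightarrow> nat \<Rightarrow> complex"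

definition lcb_norm :: "cmat_maps \<Rightarrow> 'e::zero os \<Rightarrow> 'f::comm_monoid_add os \<Rightarrow> ('e \<Rightarrow> 'f) \<Rightarrow> ennreal" where
  "lcb_norm \<Lambda> E F \<phi> = (SUP n\<in>{1..}. op_norm (mats (os_carrier E) n n) (os_norm E n) (os_norm F n)
                                       (tensor_map (os_scale F) n \<phi> (\<Lambda> n)))"

text \<open>Maps on the carrier of \<open>E\<close> are represented by functions that vanish outside it.\<close>

definition lcb_maps :: "cmat_maps \<Rightarrow> 'e::monoid_add os \<Rightarrow> 'f::comm_monoid_add os \<Rightarrow> ('e \<Rightarrow> 'f) set" where
  "lcb_maps \<Lambda> E F = {\<phi>. linear_map E F \<phi> \<and> (\<forall>x. x \<notin> os_carrier E \<longrightarrow> \<phi> x = 0) \<and> lcb_norm \<Lambda> E F \<phi> < \<infinity>}"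

definition mat_of_maps :: "(nat \<Rightarrow> nat \<Rightarrow> 'e \<Rightarrow> 'f) \<Rightarrow> 'e \<Rightarrow> nat \<Rightarrow> nat \<Rightarrow> 'f" where
  "mat_of_maps \<Phi> = (\<lambda>e i j. \<Phi> i j e)"

definition CB_os :: "cmat_maps \<Rightarrow> 'e::monoid_add os \<Rightarrow> 'f::comm_monoid_add os \<Rightarrow> ('e \<Rightarrow> 'f) os" where
  "CB_os \<Lambda> E F = \<lparr>os_carrier = lcb_maps \<Lambda> E F,
                  os_scale = (\<lambda>c \<phi> x. os_scale F c (\<phi> x)),
                  os_norm = (\<lambda>n \<Phi>. enn2real (lcb_norm \<Lambda> E (mat_os n F) (mat_of_maps \<Phi>)))\<rparr>"

end

theory Submission
  imports Defs
begin

text \<open>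
  The norm of \<open>\<phi> \<otimes> \<lambda>\<^sub>k\<close> only sees \<open>\<phi>\<close> through \<open>M\<^sub>k\<^sub>n(F)\<close>: amplifying \<open>\<alpha>\<Phi>\<beta>\<close> gives the amplification of
  \<open>\<Phi>\<close> multiplied by \<open>1\<^sub>k \<otimes> \<alpha>\<close> and \<open>1\<^sub>k \<otimes> \<beta>\<close>, whose norms are those of \<open>\<alpha>\<close> and \<open>\<beta>\<close>, and
  amplifying \<open>\<Phi> \<oplus> \<Psi>\<close> gives, up to a permutation of rows and columns, the direct sum of the
  amplifications. So Ruan's axioms pass from \<open>F\<close> to the mapping space. Compressing to and embedding
  from single entries, both instances of (R2), show that \<open>\<Phi>\<close> has finite norm iff its entries do.
  Definiteness comes from \<open>\<lambda>\<^sub>1\<close> being multiplication by a non-zero scalar.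
\<close>

section \<open>Block sums and norms of scalar matrices\<close>

text \<open>Splits an index into block number \<open>u\<close> and position \<open>p\<close> inside
  the block, the indexing under which \<open>mat_flatten\<close> reads a matrix of matrices.\<close>

lemma sum_lessThan_mult:
  fixes f :: "nat \<Rightarrow> 'a::comm_monoid_add"
  shows "(\<Sum>i<k*n. f i) = (\<Sum>u<k. \<Sum>p<n. f (u * n + p))"
proof -
  have "(\<Sum>i<k*n. f i) = (\<Sum>u<k. sum f {u*n..<u*n+n})"
    by (simp add: sum.nat_group)
  also have "\<dots> = (\<Sum>u<k. \<Sum>p<n. f (u * n + p))"
  proof (rule sum.cong[OF refl])
    fix u
    show "sum f {u*n..<u*n+n} = (\<Sum>p<n. f (u * n + p))"
      by (rule sum.reindex_bij_witness[where i = "\<lambda>p. u * n + p" and j = "\<lambda>i. i - u * n"]) auto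
  qed
  finally show ?thesis .
qed

lemma l2norm_nonneg: "l2norm n \<xi> \<ge> 0"
  by (simp add: l2norm_def)

lemma l2norm_square: "(l2norm n \<xi>)\<^sup>2 = (\<Sum>i<n. (cmod (\<xi> i))\<^sup>2)"
  by (simp add: l2norm_def L2_set_def sum_nonneg)

lemma l2norm_scale: "l2norm n (\<lambda>i. c * \<xi> i) = cmod c * l2norm n \<xi>"
  by (simp add: l2norm_def norm_mult L2_set_right_distrib)

lemma cmod_le_l2norm: "i < n \<Longrightarrow> cmod (\<xi> i) \<le> l2norm n \<xi>"
  unfolding l2norm_def by (rule member_le_L2_set) auto

text \<open>A crude entrywise bound; it serves to show that the operator norm of a scalar matrix is
  finite and that vectors of norm zero have images of norm zero.\<close>

lemma l2norm_mat_le_sum: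
  "l2norm m (\<lambda>i. \<Sum>j<n. \<alpha> i j * \<xi> j) \<le> (\<Sum>i<m. \<Sum>j<n. cmod (\<alpha> i j)) * l2norm n \<xi>"
proof -
  have "l2norm m (\<lambda>i. \<Sum>j<n. \<alpha> i j * \<xi> j) \<le> (\<Sum>i<m. cmod (\<Sum>j<n. \<alpha> i j * \<xi> j))"
    unfolding l2norm_def by (rule L2_set_le_sum) simp
  also have "\<dots> \<le> (\<Sum>i<m. \<Sum>j<n. cmod (\<alpha> i j) * l2norm n \<xi>)"
    by (intro sum_mono order.trans[OF norm_sum])
      (auto simp: norm_mult intro!: mult_left_mono cmod_le_l2norm)
  finally show ?thesis by (simp add: sum_distrib_right)
qed

lemma cmat_norm_nonneg: "cmat_norm m n \<alpha> \<ge> 0"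
  by (simp add: cmat_norm_def)

lemma op_norm_leI:
  assumes "\<And>x. x \<in> X \<Longrightarrow> p x \<le> 1 \<Longrightarrow> ennreal (q (T x)) \<le> c"
  shows "op_norm X p q T \<le> c"
  unfolding op_norm_def by (rule SUP_least) (use assms in auto)

lemma op_norm_upper: "x \<in> X \<Longrightarrow> p x \<le> 1 \<Longrightarrow> ennreal (q (T x)) \<le> op_norm X p q T"
  unfolding op_norm_def by (rule SUP_upper) auto

text \<open>By homogeneity: the estimate on the unit ball is applied to \<xi> divided by its norm.
  Finiteness has to come first, since \<open>enn2real\<close> sends infinity to 0 and would then
  bound nothing.\<close>

lemma cmat_norm_bound:
  "l2norm m (\<lambda>i. \<Sum>j<n. \<alpha> i j * \<xi> j) \<le> cmat_norm m n \<alpha> * l2norm n \<xi>"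
proof -
  let ?T = "\<lambda>\<xi> i. \<Sum>j<n. \<alpha> i j * \<xi> j"
  let ?S = "\<Sum>i<m. \<Sum>j<n. cmod (\<alpha> i j)"
  have S: "?S \<ge> 0" by (intro sum_nonneg) auto
  have "op_norm UNIV (l2norm n) (l2norm m) ?T \<le> ennreal ?S"
    by (rule op_norm_leI)
      (use l2norm_mat_le_sum S in \<open>blast intro: ennreal_leI order.trans mult_left_le\<close>)
  then have fin: "op_norm UNIV (l2norm n) (l2norm m) ?T < \<infinity>"
    by (rule order.strict_trans1) simp
  have unit: "l2norm m (?T \<eta>) \<le> cmat_norm m n \<alpha>" if "l2norm n \<eta> \<le> 1" for \<eta>
  proof -
    have "ennreal (l2norm m (?T \<eta>)) \<le> op_norm UNIV (l2norm n) (l2norm m) ?T"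
      by (rule op_norm_upper) (use that in auto)
    then have "enn2real (ennreal (l2norm m (?T \<eta>))) \<le> cmat_norm m n \<alpha>"
      unfolding cmat_norm_def by (rule enn2real_mono) (use fin in simp)
    then show ?thesis by (simp add: l2norm_nonneg)
  qed
  show ?thesis
  proof (cases "l2norm n \<xi> = 0")
    \<comment> \<open>Such a vector cannot be normalised, but the crude bound makes the left side
      vanish.\<close>
    case True
    then show ?thesis using l2norm_mat_le_sum[where m = m and \<alpha> = \<alpha> and n = n and \<xi> = \<xi>] by simp
  next
    case False
    then have pos: "l2norm n \<xi> > 0" using l2norm_nonneg[of n \<xi>] by simp
    let ?c = "complex_of_real (inverse (l2norm n \<xi>))"
    have "l2norm n (\<lambda>i. ?c * \<xi> i) \<le> 1"
      using pos by (simp only: l2norm_scale norm_of_real) (simp add: norm_inverse)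
    from unit[OF this] have "l2norm m (\<lambda>i. ?c * ?T \<xi> i) \<le> cmat_norm m n \<alpha>"
      by (simp only: sum_distrib_left mult.left_commute)
    then have "inverse (l2norm n \<xi>) * l2norm m (?T \<xi>) \<le> cmat_norm m n \<alpha>"
      using pos by (simp only: l2norm_scale norm_of_real) simp
    then show ?thesis using pos by (simp add: field_simps)
  qed
qed

lemma cmat_norm_leI:
  assumes "c \<ge> 0" "\<And>\<xi>. l2norm m (\<lambda>i. \<Sum>j<n. \<alpha> i j * \<xi> j) \<le> c * l2norm n \<xi>"
  shows "cmat_norm m n \<alpha> \<le> c"
proof -
  have "op_norm UNIV (l2norm n) (l2norm m) (\<lambda>\<xi> i. \<Sum>j<n. \<alpha> i j * \<xi> j) \<le> ennreal c"
    by (rule op_norm_leI) (use assms in \<open>blast intro: ennreal_leI order.trans mult_left_le\<close>)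
  then have "cmat_norm m n \<alpha> \<le> enn2real (ennreal c)"
    unfolding cmat_norm_def by (rule enn2real_mono) simp
  then show ?thesis using assms(1) by simp
qed

text \<open>The matrix \<open>1\<^sub>k \<otimes> \<alpha>\<close>, in the block convention of \<^const>\<open>mat_flatten\<close>.\<close>

definition mat_ampl :: "nat \<Rightarrow> nat \<Rightarrow> nat \<Rightarrow> (nat \<Rightarrow> nat \<Rightarrow> complex) \<Rightarrow> nat \<Rightarrow> nat \<Rightarrow> complex" where
  "mat_ampl k m n \<alpha> = (\<lambda>i j. if i < k * m \<and> j < k * n \<and> i div m = j div n
                             then \<alpha> (i mod m) (j mod n) else 0)"

lemma mat_ampl_mats: "mat_ampl k m n \<alpha> \<in> mats UNIV (k * m) (k * n)"
  by (auto simp: mats_def mat_ampl_def)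

lemma block_index_less: "u < k \<Longrightarrow> p < n \<Longrightarrow> u * n + p < k * (n::nat)"
  using mult_le_mono1[of "Suc u" k n] by simp

lemma mat_ampl_block:
  assumes "u < k" "p < n" "m \<ge> 1" "i < k * m"
  shows "mat_ampl k m n \<alpha> i (u * n + p) = (if i div m = u then \<alpha> (i mod m) p else 0)"
  using assms block_index_less[OF assms(1,2)] by (auto simp: mat_ampl_def)

text \<open>The matrix is block diagonal with \<open>k\<close> copies of \<alpha>, so it acts on the
  \<open>k\<close> blocks of a vector separately, and the squared norms of the blocks add
  up.\<close>

lemma cmat_norm_mat_ampl:
  assumes "m \<ge> 1"
  shows "cmat_norm (k * m) (k * n) (mat_ampl k m n \<alpha>) \<le> cmat_norm m n \<alpha>"
proof (rule cmat_norm_leI[OF cmat_norm_nonneg])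
  fix \<xi>
  let ?c = "cmat_norm m n \<alpha>"
  have entry: "(\<Sum>j<k*n. mat_ampl k m n \<alpha> (v * m + r) j * \<xi> j) = (\<Sum>p<n. \<alpha> r p * \<xi> (v * n + p))"
    if "v < k" "r < m" for v r
  proof -
    have "(\<Sum>j<k*n. mat_ampl k m n \<alpha> (v * m + r) j * \<xi> j)
        = (\<Sum>u<k. if u = v then (\<Sum>p<n. \<alpha> r p * \<xi> (v * n + p)) else 0)"
      unfolding sum_lessThan_mult
      using that assms block_index_less[OF that]
      by (intro sum.cong refl) (auto simp: mat_ampl_block intro!: sum.neutral)
    then show ?thesis using that by simp
  qed
  have "(l2norm (k * m) (\<lambda>i. \<Sum>j<k*n. mat_ampl k m n \<alpha> i j * \<xi> j))\<^sup>2
      = (\<Sum>v<k. (l2norm m (\<lambda>r. \<Sum>p<n. \<alpha> r p * \<xi> (v * n + p)))\<^sup>2)"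
    unfolding l2norm_square sum_lessThan_mult[of _ k m] by (intro sum.cong refl) (simp add: entry)
  also have "\<dots> \<le> (\<Sum>v<k. (?c * l2norm n (\<lambda>p. \<xi> (v * n + p)))\<^sup>2)"
    by (intro sum_mono power_mono l2norm_nonneg cmat_norm_bound)
  also have "\<dots> = (?c * l2norm (k * n) \<xi>)\<^sup>2"
    by (simp add: power_mult_distrib l2norm_square sum_lessThan_mult sum_distrib_left)
  finally show "l2norm (k * m) (\<lambda>i. \<Sum>j<k*n. mat_ampl k m n \<alpha> i j * \<xi> j) \<le> ?c * l2norm (k * n) \<xi>"
    by (rule power2_le_imp_le) (simp add: cmat_norm_nonneg l2norm_nonneg)
qed

definition perm_mat :: "nat \<Rightarrow> (nat \<Rightarrow> nat) \<Rightarrow> nat \<Rightarrow> nat \<Rightarrow> complex" where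
  "perm_mat n \<sigma> = (\<lambda>i j. if i < n \<and> j < n \<and> j = \<sigma> i then 1 else 0)"

lemma perm_mat_mats: "perm_mat n \<sigma> \<in> mats UNIV n n"
  by (auto simp: mats_def perm_mat_def)

lemma cmat_norm_perm_mat:
  assumes "bij_betw \<sigma> {..<n} {..<n}"
  shows "cmat_norm n n (perm_mat n \<sigma>) \<le> 1"
proof (rule cmat_norm_leI)
  fix \<xi>
  have "\<sigma> i < n" if "i < n" for i using assms that by (auto simp: bij_betw_def)
  then have "(l2norm n (\<lambda>i. \<Sum>j<n. perm_mat n \<sigma> i j * \<xi> j))\<^sup>2 = (\<Sum>i<n. (cmod (\<xi> (\<sigma> i)))\<^sup>2)"
    unfolding l2norm_square
    by (intro sum.cong refl) (simp add: perm_mat_def if_distribR if_distrib[of "\<lambda>t. t * _"] cong: if_cong)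
  also have "\<dots> = (l2norm n \<xi>)\<^sup>2"
    unfolding l2norm_square by (rule sum.reindex_bij_betw[OF assms])
  finally show "l2norm n (\<lambda>i. \<Sum>j<n. perm_mat n \<sigma> i j * \<xi> j) \<le> 1 * l2norm n \<xi>"
    by (simp add: l2norm_nonneg power2_eq_iff_nonneg)
qed simp

section \<open>Permutations and direct sums in an operator space\<close>

context operator_space
begin

lemma scale_indicator: "os_scale V (if P then 1 else 0) x = (if P then x else 0)"
  by simp

text \<open>This is (R2) with the permutation matrix of \<sigma> on the left and that of its inverse
  \<tau> on the right, both of norm at most 1.\<close>

lemma norm_permute_le:
  assumes "n \<ge> 1" "v \<in> mats (os_carrier V) n n" and \<sigma>: "bij_betw \<sigma> {..<n} {..<n}"
  shows "os_norm V n (\<lambda>i j. if i < n \<and> j < n then v (\<sigma> i) (\<sigma> j) else 0) \<le> os_norm V n v"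
proof -
  define \<tau> where "\<tau> = the_inv_into {..<n} \<sigma>"
  have \<tau>: "bij_betw \<tau> {..<n} {..<n}"
    unfolding \<tau>_def by (rule bij_betw_the_inv_into[OF \<sigma>])
  have \<sigma>_less: "\<sigma> i < n" if "i < n" for i using \<sigma> that by (auto simp: bij_betw_def)
  \<comment> \<open>Column \<open>j\<close> of the right factor therefore has its only 1 in row
    \<open>\<sigma> j\<close>, so rows and columns are permuted alike.\<close>
  have \<tau>_iff: "j = \<tau> l \<longleftrightarrow> l = \<sigma> j" if "j < n" "l < n" for j l
    unfolding \<tau>_def using \<sigma> that
    by (metis bij_betw_def f_the_inv_into_f_bij_betw lessThan_iff the_inv_into_f_f)
  have "(\<Sum>k<n. \<Sum>l<n. os_scale V (perm_mat n \<sigma> i k * perm_mat n \<tau> l j) (v k l))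
      = (if i < n \<and> j < n then v (\<sigma> i) (\<sigma> j) else 0)" for i j
  proof -
    have "(\<Sum>k<n. \<Sum>l<n. os_scale V (perm_mat n \<sigma> i k * perm_mat n \<tau> l j) (v k l))
      = (\<Sum>k<n. if k = \<sigma> i then (\<Sum>l<n. if l = \<sigma> j then (if i < n \<and> j < n then v (\<sigma> i) (\<sigma> j) else 0) else 0) else 0)"
      by (intro sum.cong refl)
        (auto simp: perm_mat_def \<tau>_iff scale_indicator intro!: sum.cong sum.neutral)
    then show ?thesis by (auto simp: \<sigma>_less)
  qed
  then have eq: "(\<lambda>i j. if i < n \<and> j < n then v (\<sigma> i) (\<sigma> j) else 0)
      = mat_sandwich (os_scale V) n (perm_mat n \<sigma>) v (perm_mat n \<tau>)"
    unfolding mat_sandwich_def by (simp add: fun_eq_iff)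
  have nn: "os_norm V n v \<ge> 0" using assms norm_nonneg by blast
  have "os_norm V n (mat_sandwich (os_scale V) n (perm_mat n \<sigma>) v (perm_mat n \<tau>))
      \<le> cmat_norm n n (perm_mat n \<sigma>) * os_norm V n v * cmat_norm n n (perm_mat n \<tau>)"
    by (rule ruan_R2) (use assms perm_mat_mats in auto)
  also have "\<dots> \<le> 1 * os_norm V n v * 1"
    by (intro mult_mono cmat_norm_perm_mat \<sigma> \<tau>) (auto simp: nn cmat_norm_nonneg)
  finally show ?thesis unfolding eq by simp
qed

lemma mat_dsum_mats:
  assumes "v \<in> mats (os_carrier V) n n" "w \<in> mats (os_carrier V) m m"
  shows "mat_dsum n v w \<in> mats (os_carrier V) (n + m) (n + m)"
  using assms subspace_0[OF carrier_subspace] by (auto simp: mats_def mat_dsum_def)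

end


section \<open>Matrix units and interchange of sums\<close>

text \<open>The left unit moves row \<open>a\<close> to row \<open>p\<close>, the right one column
  \<open>b\<close> to column \<open>q\<close>. With \<open>p = q = 0\<close> this compresses to a
  single entry; with \<open>n = 1\<close> it embeds a single entry at position
  \<open>(p, q)\<close>.\<close>

lemma mat_sandwich_unit:
  fixes s :: "complex \<Rightarrow> 'v::ab_group_add \<Rightarrow> 'v"
  assumes "vector_space s" "a < n" "b < n"
  shows "mat_sandwich s n (mat_unit p a) v (mat_unit b q)
    = (\<lambda>i j. if i = p \<and> j = q then v a b else 0)"
proof (intro ext)
  interpret vector_space s by fact
  have s_indicator: "s (if P then 1 else 0) x = (if P then x else 0)" for P x
    by simp
  fix i j
  have "(\<Sum>k<n. \<Sum>l<n. s (mat_unit p a i k * mat_unit b q l j) (v k l))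
      = (\<Sum>k<n. if k = a then (\<Sum>l<n. if l = b then (if i = p \<and> j = q then v a b else 0) else 0) else 0)"
    by (intro sum.cong refl) (auto simp: mat_unit_def s_indicator intro!: sum.cong sum.neutral)
  then show "mat_sandwich s n (mat_unit p a) v (mat_unit b q) i j
      = (if i = p \<and> j = q then v a b else 0)"
    using assms by (simp add: mat_sandwich_def)
qed

lemma sum_fun_apply: "(\<Sum>a\<in>A. f a) x = (\<Sum>a\<in>A. f a x)"
  by (induction A rule: infinite_finite_induct) auto

lemma sum_swap_pairs:
  "(\<Sum>a\<in>A. \<Sum>b\<in>B. \<Sum>p\<in>C. \<Sum>q\<in>D. f a b p q) = (\<Sum>p\<in>C. \<Sum>q\<in>D. \<Sum>a\<in>A. \<Sum>b\<in>B. f a b p q)"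
proof -
  have "(\<Sum>a\<in>A. \<Sum>b\<in>B. \<Sum>p\<in>C. \<Sum>q\<in>D. f a b p q) = (\<Sum>a\<in>A. \<Sum>p\<in>C. \<Sum>b\<in>B. \<Sum>q\<in>D. f a b p q)"
    by (intro sum.cong refl sum.swap)
  also have "\<dots> = (\<Sum>p\<in>C. \<Sum>a\<in>A. \<Sum>b\<in>B. \<Sum>q\<in>D. f a b p q)"
    by (rule sum.swap)
  also have "\<dots> = (\<Sum>p\<in>C. \<Sum>a\<in>A. \<Sum>q\<in>D. \<Sum>b\<in>B. f a b p q)"
    by (intro sum.cong refl sum.swap)
  also have "\<dots> = (\<Sum>p\<in>C. \<Sum>q\<in>D. \<Sum>a\<in>A. \<Sum>b\<in>B. f a b p q)"
    by (intro sum.cong refl sum.swap)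
  finally show ?thesis .
qed

lemma mat_unit_mats: "k < m \<Longrightarrow> l < n \<Longrightarrow> mat_unit k l \<in> mats UNIV m n"
  by (auto simp: mats_def mat_unit_def)

section \<open>The row permutation for direct sums\<close>

text \<open>Rows of \<open>(\<Phi> \<oplus> \<Psi>)(x)\<close> come in \<open>k\<close> groups, each with \<open>n\<close> rows of \<open>\<Phi>\<close> followed by \<open>m\<close> rows
  of \<open>\<Psi>\<close>; this map sends a row index to its place when all rows of \<open>\<Phi>\<close> precede those of \<open>\<Psi>\<close>.\<close>

definition shuffle :: "nat \<Rightarrow> nat \<Rightarrow> nat \<Rightarrow> nat \<Rightarrow> nat" where
  "shuffle k n m i = (if i mod (n + m) < n then i div (n + m) * n + i mod (n + m)
                      else k * n + (i div (n + m) * m + (i mod (n + m) - n)))"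

lemma shuffle_left:
  assumes "n \<ge> 1" "i < k * (n + m)" "i mod (n + m) < n"
  shows "shuffle k n m i < k * n" "shuffle k n m i div n = i div (n + m)"
    "shuffle k n m i mod n = i mod (n + m)"
proof -
  have "i div (n + m) < k" using assms(2) by (rule less_mult_imp_div_less)
  then show "shuffle k n m i < k * n"
    using assms(3) by (simp add: shuffle_def block_index_less)
qed (use assms in \<open>simp_all add: shuffle_def\<close>)

lemma shuffle_right:
  assumes "n \<ge> 1" "i < k * (n + m)" "\<not> i mod (n + m) < n"
  shows "k * n \<le> shuffle k n m i" "shuffle k n m i < k * (n + m)"
    "(shuffle k n m i - k * n) div m = i div (n + m)"
    "(shuffle k n m i - k * n) mod m = i mod (n + m) - n"
proof -
  have u: "i div (n + m) < k" using assms(2) by (rule less_mult_imp_div_less)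
  have "i mod (n + m) < n + m" using assms(1) by simp
  then have r: "i mod (n + m) - n < m" using assms(3) by linarith
  show "k * n \<le> shuffle k n m i" using assms(3) by (simp add: shuffle_def)
  show "shuffle k n m i < k * (n + m)"
    using assms(3) block_index_less[OF u r] by (simp add: shuffle_def distrib_left)
  show "(shuffle k n m i - k * n) div m = i div (n + m)"
    "(shuffle k n m i - k * n) mod m = i mod (n + m) - n"
    using assms(3) r by (simp_all add: shuffle_def del: Nat.add_diff_assoc)
qed

text \<open>An explicit left inverse gives injectivity, and an injective self-map of a finite set is
  onto.\<close>

lemma shuffle_bij:
  assumes "n \<ge> 1"
  shows "bij_betw (shuffle k n m) {..<k * (n + m)} {..<k * (n + m)}"
proof -
  have "shuffle k n m i < k * (n + m)" if "i < k * (n + m)" for i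
    using shuffle_left(1)[OF assms that] shuffle_right(2)[OF assms that]
    by (cases "i mod (n + m) < n") (auto simp: distrib_left)
  then have into: "shuffle k n m ` {..<k * (n + m)} \<subseteq> {..<k * (n + m)}" by auto
  \<comment> \<open>Places below \<open>k * n\<close> hold the rows of \<Phi>; in either range the
    quotient is the group and the remainder the position within it, shifted by \<open>n\<close> for
    rows of \<Psi>.\<close>
  define dec where "dec y = (if y < k * n then y div n * (n + m) + y mod n
    else (y - k * n) div m * (n + m) + (n + (y - k * n) mod m))" for y
  have "dec (shuffle k n m i) = i" if "i < k * (n + m)" for i
  proof -
    have "dec (shuffle k n m i) = i div (n + m) * (n + m) + i mod (n + m)"
      using shuffle_left[OF assms that] shuffle_right[OF assms that]
      by (cases "i mod (n + m) < n") (simp_all add: dec_def)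
    then show ?thesis by (simp only: div_mult_mod_eq)
  qed
  then have "inj_on (shuffle k n m) {..<k * (n + m)}"
    by (intro inj_on_inverseI[of _ dec]) auto
  with into show ?thesis by (simp add: bij_betw_def endo_inj_surj)
qed

text \<open>For products with block diagonal matrices, where a given entry only sees one pair of
  blocks.\<close>

lemma sum_block_collapse:
  assumes "u < (k::nat)" "v < (l::nat)"
  shows "(\<Sum>u'<k. \<Sum>p\<in>P. \<Sum>v'<l. \<Sum>q\<in>Q. if u' = u \<and> v' = v then g p q else 0) = (\<Sum>p\<in>P. \<Sum>q\<in>Q. g p q)"
proof -
  have "(\<Sum>v'<l. \<Sum>q\<in>Q. if u' = u \<and> v' = v then g p q else 0)
      = (if u' = u then \<Sum>q\<in>Q. g p q else 0)" for u' p
  proof -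
    have "(\<Sum>v'<l. \<Sum>q\<in>Q. if u' = u \<and> v' = v then g p q else 0)
        = (\<Sum>v'<l. if v' = v then (if u' = u then \<Sum>q\<in>Q. g p q else 0) else 0)"
      by (rule sum.cong) auto
    then show ?thesis using assms by simp
  qed
  then have "(\<Sum>u'<k. \<Sum>p\<in>P. \<Sum>v'<l. \<Sum>q\<in>Q. if u' = u \<and> v' = v then g p q else 0)
      = (\<Sum>u'<k. if u' = u then \<Sum>p\<in>P. \<Sum>q\<in>Q. g p q else 0)"
    by (intro sum.cong refl) auto
  then show ?thesis using assms by simp
qed

section \<open>Linear maps and the sequence \<Lambda>\<close>

locale lcb_setting = E: operator_space E + F: operator_space F
  for E :: "'e::ab_group_add os" and F :: "'f::ab_group_add os" +
  fixes \<Lambda> :: cmat_maps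
  assumes \<Lambda>_linear: "\<And>n. n \<ge> 1 \<Longrightarrow> linear_map (mat_os n complex_os) (mat_os n complex_os) (\<Lambda> n)"
    and \<Lambda>_nonzero: "\<exists>A \<in> mats UNIV 1 1. \<Lambda> 1 A \<noteq> 0"
begin

lemma \<Lambda>_mats: "k \<ge> 1 \<Longrightarrow> A \<in> mats UNIV k k \<Longrightarrow> \<Lambda> k A \<in> mats UNIV k k"
  using \<Lambda>_linear[of k] by (auto simp: linear_map_def mat_os_def complex_os_def)

lemma \<Lambda>_unit_outside:
  "k \<ge> 1 \<Longrightarrow> a < k \<Longrightarrow> b < k \<Longrightarrow> i \<ge> k \<or> j \<ge> k \<Longrightarrow> \<Lambda> k (mat_unit a b) i j = 0"
  using \<Lambda>_mats[OF _ mat_unit_mats, of k a b] by (auto simp: mats_def)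

text \<open>One matrix unit spans the 1 by 1 matrices, so if its image vanished,
  \<open>\<Lambda> 1\<close> would be zero by linearity.\<close>

lemma \<Lambda>_unit_nonzero: "\<Lambda> 1 (mat_unit 0 0) 0 0 \<noteq> 0"
proof
  assume 0: "\<Lambda> 1 (mat_unit 0 0) 0 0 = 0"
  have unit: "mat_unit 0 0 \<in> mats UNIV 1 1" by (rule mat_unit_mats) auto
  have "\<Lambda> 1 (mat_unit 0 0) = 0"
  proof (intro ext)
    fix i j
    show "\<Lambda> 1 (mat_unit 0 0) i j = 0 i j"
      using 0 \<Lambda>_mats[OF _ unit] by (cases "i = 0 \<and> j = 0") (auto simp: mats_def Suc_le_eq)
  qed
  obtain A where A: "A \<in> mats UNIV 1 1" "\<Lambda> 1 A \<noteq> 0" using \<Lambda>_nonzero by blast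
  have A_eq: "A = (\<lambda>i j. A 0 0 * mat_unit 0 0 i j)"
    using A(1) by (auto simp: mats_def mat_unit_def fun_eq_iff)
  have "\<Lambda> 1 (\<lambda>i j. A 0 0 * mat_unit 0 0 i j) = (\<lambda>i j. A 0 0 * \<Lambda> 1 (mat_unit 0 0) i j)"
    using \<Lambda>_linear[of 1] unit by (auto simp: linear_map_def mat_os_def complex_os_def)
  also have "\<dots> = 0" by (simp only: \<open>\<Lambda> 1 (mat_unit 0 0) = 0\<close>) (simp add: fun_eq_iff)
  finally show False using A(2) A_eq by metis
qed

abbreviation map_scale :: "complex \<Rightarrow> ('e \<Rightarrow> 'f) \<Rightarrow> 'e \<Rightarrow> 'f" where
  "map_scale \<equiv> \<lambda>c \<phi> x. os_scale F c (\<phi> x)"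

lemma vector_space_map_scale: "vector_space map_scale"
  by unfold_locales (auto simp: fun_eq_iff F.scale_right_distrib F.scale_left_distrib)

sublocale maps: vector_space map_scale
  by (rule vector_space_map_scale)

text \<open>The candidates before any bound is imposed. The norm estimates are proved for matrices
  of these, with values in \<open>ennreal\<close>, so that finiteness can be deduced from the
  estimates themselves.\<close>

definition lin_maps :: "('e \<Rightarrow> 'f) set" where
  "lin_maps = {\<phi>. linear_map E F \<phi> \<and> (\<forall>x. x \<notin> os_carrier E \<longrightarrow> \<phi> x = 0)}"

lemma lcb_maps_iff: "\<phi> \<in> lcb_maps \<Lambda> E F \<longleftrightarrow> \<phi> \<in> lin_maps \<and> lcb_norm \<Lambda> E F \<phi> < \<infinity>"
  by (auto simp: lcb_maps_def lin_maps_def)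

lemma lin_maps_subspace: "maps.subspace lin_maps"
proof (rule maps.subspaceI)
  show "0 \<in> lin_maps"
    using F.subspace_0[OF F.carrier_subspace] by (simp add: lin_maps_def linear_map_def)
next
  fix \<phi> \<psi> assume "\<phi> \<in> lin_maps" "\<psi> \<in> lin_maps"
  then show "\<phi> + \<psi> \<in> lin_maps"
    using F.subspace_add[OF F.carrier_subspace]
    by (auto simp: lin_maps_def linear_map_def F.scale_right_distrib)
next
  fix c \<phi> assume "\<phi> \<in> lin_maps"
  then show "map_scale c \<phi> \<in> lin_maps"
    using F.subspace_scale[OF F.carrier_subspace]
    by (auto simp: lin_maps_def linear_map_def F.scale_right_distrib mult.commute)
qed

section \<open>Amplifications of matrices of maps\<close>

text \<open>\<open>(\<Phi> \<otimes> \<lambda>\<^sub>k)(x)\<close> as a \<open>kn \<times> kn\<close> matrix over \<open>F\<close>.\<close>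

definition amp :: "nat \<Rightarrow> nat \<Rightarrow> (nat \<Rightarrow> nat \<Rightarrow> 'e \<Rightarrow> 'f) \<Rightarrow> (nat \<Rightarrow> nat \<Rightarrow> 'e) \<Rightarrow> nat \<Rightarrow> nat \<Rightarrow> 'f" where
  "amp n k \<Phi> x = mat_flatten n (tensor_map (os_scale (mat_os n F)) k (mat_of_maps \<Phi>) (\<Lambda> k) x)"

lemma amp_apply: "amp n k \<Phi> x i j = (\<Sum>a<k. \<Sum>b<k.
    os_scale F (\<Lambda> k (mat_unit a b) (i div n) (j div n)) (\<Phi> (i mod n) (j mod n) (x a b)))"
  by (simp add: amp_def mat_flatten_def tensor_map_def mat_os_def mat_of_maps_def sum_fun_apply)

abbreviation cbn :: "nat \<Rightarrow> (nat \<Rightarrow> nat \<Rightarrow> 'e \<Rightarrow> 'f) \<Rightarrow> ennreal" where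
  "cbn n \<Phi> \<equiv> lcb_norm \<Lambda> E (mat_os n F) (mat_of_maps \<Phi>)"

lemma cbn_leI:
  assumes "\<And>k x. k \<ge> 1 \<Longrightarrow> x \<in> mats (os_carrier E) k k \<Longrightarrow> os_norm E k x \<le> 1 \<Longrightarrow>
    ennreal (os_norm F (k * n) (amp n k \<Phi> x)) \<le> c"
  shows "cbn n \<Phi> \<le> c"
  unfolding lcb_norm_def using assms
  by (intro SUP_least op_norm_leI) (auto simp: amp_def mat_os_def)

lemma cbn_upper:
  assumes "k \<ge> 1" "x \<in> mats (os_carrier E) k k" "os_norm E k x \<le> 1"
  shows "ennreal (os_norm F (k * n) (amp n k \<Phi> x)) \<le> cbn n \<Phi>"
proof -
  have "ennreal (os_norm F (k * n) (amp n k \<Phi> x)) \<le>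
      op_norm (mats (os_carrier E) k k) (os_norm E k) (os_norm (mat_os n F) k)
        (tensor_map (os_scale (mat_os n F)) k (mat_of_maps \<Phi>) (\<Lambda> k))"
    using op_norm_upper[where p = "os_norm E k" and q = "os_norm (mat_os n F) k", OF assms(2,3)]
    by (simp add: amp_def mat_os_def)
  also have "\<dots> \<le> cbn n \<Phi>"
    unfolding lcb_norm_def by (rule SUP_upper) (use assms in auto)
  finally show ?thesis .
qed

lemma amp_mats:
  assumes "n \<ge> 1" "k \<ge> 1" "\<Phi> \<in> mats lin_maps n n" "x \<in> mats (os_carrier E) k k"
  shows "amp n k \<Phi> x \<in> mats (os_carrier F) (k * n) (k * n)"
proof -
  have mem: "\<Phi> p q y \<in> os_carrier F" if "p < n" "q < n" "y \<in> os_carrier E" for p q y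
    using assms(3) that by (auto simp: mats_def lin_maps_def linear_map_def)
  have "amp n k \<Phi> x i j \<in> os_carrier F" if "i < k * n" "j < k * n" for i j
    unfolding amp_apply using assms that
    by (intro F.subspace_sum F.subspace_scale F.carrier_subspace mem) (auto simp: mats_def)
  \<comment> \<open>An index from \<open>k * n\<close> on lies in a block numbered at least
    \<open>k\<close>, where the images of the matrix units under \<open>\<Lambda> k\<close> have no
    entries.\<close>
  moreover have "amp n k \<Phi> x i j = 0" if "i \<ge> k * n \<or> j \<ge> k * n" for i j
  proof -
    have "i div n \<ge> k \<or> j div n \<ge> k"
      using that assms(1) by (auto simp: less_eq_div_iff_mult_less_eq)
    then show ?thesis
      unfolding amp_apply using assms(2) by (intro sum.neutral ballI) (simp add: \<Lambda>_unit_outside)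
  qed
  ultimately show ?thesis by (auto simp: mats_def)
qed

lemma amp_add: "amp n k (\<Phi> + \<Psi>) x = amp n k \<Phi> x + amp n k \<Psi> x"
  by (simp add: fun_eq_iff amp_apply F.scale_right_distrib sum.distrib)

lemma amp_scale: "amp n k (\<lambda>i j. map_scale c (\<Phi> i j)) x = (\<lambda>i j. os_scale F c (amp n k \<Phi> x i j))"
  by (simp add: fun_eq_iff amp_apply F.scale_sum_right mult.commute)

lemma amp_single: "amp 1 k (\<lambda>i j. if i = 0 \<and> j = 0 then \<phi> else 0) x = tensor_map (os_scale F) k \<phi> (\<Lambda> k) x"
  by (simp add: fun_eq_iff amp_apply tensor_map_def)

text \<open>Identifies single maps with 1 by 1 matrices, so that facts about
  \<open>lcb_norm \<Lambda> E F\<close> become the case \<open>n = 1\<close> of facts about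
  \<open>cbn\<close>.\<close>

lemma cbn_single: "cbn 1 (\<lambda>i j. if i = 0 \<and> j = 0 then \<phi> else 0) = lcb_norm \<Lambda> E F \<phi>"
  unfolding lcb_norm_def op_norm_def
  by (intro SUP_cong refl) (simp add: amp_single[symmetric, unfolded amp_def] mat_os_def)

text \<open>\<open>\<Lambda> k\<close> acts on the block numbers, \<alpha> and \<beta> on the
  positions inside a block, so the two operations commute; what remains is an interchange of finite
  sums.\<close>

lemma amp_sandwich:
  assumes "n \<ge> 1" "m \<ge> 1" "k \<ge> 1"
  shows "amp m k (mat_sandwich map_scale n \<alpha> \<Phi> \<beta>) x
    = mat_sandwich (os_scale F) (k * n) (mat_ampl k m n \<alpha>) (amp n k \<Phi> x) (mat_ampl k n m \<beta>)"
proof (intro ext)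
  fix i j
  let ?s = "os_scale F"
  show "amp m k (mat_sandwich map_scale n \<alpha> \<Phi> \<beta>) x i j
    = mat_sandwich ?s (k * n) (mat_ampl k m n \<alpha>) (amp n k \<Phi> x) (mat_ampl k n m \<beta>) i j"
  proof (cases "i < k * m \<and> j < k * m")
    case False
    then have "i div m \<ge> k \<or> j div m \<ge> k"
      using assms by (auto simp: less_eq_div_iff_mult_less_eq)
    then have "amp m k (mat_sandwich map_scale n \<alpha> \<Phi> \<beta>) x i j = 0"
      unfolding amp_apply using assms by (intro sum.neutral ballI) (simp add: \<Lambda>_unit_outside)
    moreover have "mat_sandwich ?s (k * n) (mat_ampl k m n \<alpha>) (amp n k \<Phi> x) (mat_ampl k n m \<beta>) i j = 0"
      unfolding mat_sandwich_def using False by (intro sum.neutral ballI) (auto simp: mat_ampl_def)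
    ultimately show ?thesis by simp
  next
    case True
    define u v where "u = i div m" and "v = j div m"
    have uv: "u < k" "v < k"
      using True by (auto simp: u_def v_def less_mult_imp_div_less)
    have col: "mat_ampl k n m \<beta> (v' * n + q) j = (if v' = v then \<beta> q (j mod m) else 0)"
      if "v' < k" "q < n" for v' q
      using that True block_index_less[OF that] assms by (auto simp: mat_ampl_def v_def)
    \<comment> \<open>Both scalar factors are block diagonal, so among all pairs of blocks only
      \<open>(u, v)\<close> contributes.\<close>
    have "mat_sandwich ?s (k * n) (mat_ampl k m n \<alpha>) (amp n k \<Phi> x) (mat_ampl k n m \<beta>) i j
      = (\<Sum>u'<k. \<Sum>p<n. \<Sum>v'<k. \<Sum>q<n. if u' = u \<and> v' = v
          then ?s (\<alpha> (i mod m) p * \<beta> q (j mod m)) (amp n k \<Phi> x (u * n + p) (v * n + q)) else 0)"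
      unfolding mat_sandwich_def sum_lessThan_mult
      using True assms by (intro sum.cong refl) (auto simp: mat_ampl_block col u_def[symmetric])
    also have "\<dots> = (\<Sum>p<n. \<Sum>q<n. ?s (\<alpha> (i mod m) p * \<beta> q (j mod m)) (amp n k \<Phi> x (u * n + p) (v * n + q)))"
      using uv by (rule sum_block_collapse)
    also have "\<dots> = (\<Sum>p<n. \<Sum>q<n. \<Sum>a<k. \<Sum>b<k. ?s (\<Lambda> k (mat_unit a b) u v)
        (?s (\<alpha> (i mod m) p * \<beta> q (j mod m)) (\<Phi> p q (x a b))))"
      by (intro sum.cong refl) (simp add: amp_apply F.scale_sum_right mult_ac)
    also have "\<dots> = (\<Sum>a<k. \<Sum>b<k. \<Sum>p<n. \<Sum>q<n. ?s (\<Lambda> k (mat_unit a b) u v)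
        (?s (\<alpha> (i mod m) p * \<beta> q (j mod m)) (\<Phi> p q (x a b))))"
      by (rule sum_swap_pairs)
    also have "\<dots> = amp m k (mat_sandwich map_scale n \<alpha> \<Phi> \<beta>) x i j"
      by (simp only: amp_apply mat_sandwich_def sum_fun_apply F.scale_sum_right u_def v_def)
    finally show ?thesis ..
  qed
qed

text \<open>The remainder of an index modulo \<open>n + m\<close> decides whether it belongs to
  \<Phi> or \<Psi>, and \<open>shuffle\<close> sends it below or above \<open>k * n\<close>
  accordingly. Entries with mixed indices are 0 on both sides.\<close>

lemma amp_dsum:
  assumes "n \<ge> 1" "m \<ge> 1" "k \<ge> 1"
  shows "amp (n + m) k (mat_dsum n \<Phi> \<Psi>) x
    = (\<lambda>i j. if i < k * (n + m) \<and> j < k * (n + m)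
             then mat_dsum (k * n) (amp n k \<Phi> x) (amp m k \<Psi> x) (shuffle k n m i) (shuffle k n m j)
             else 0)"
proof (intro ext)
  fix i j
  show "amp (n + m) k (mat_dsum n \<Phi> \<Psi>) x i j = (if i < k * (n + m) \<and> j < k * (n + m)
             then mat_dsum (k * n) (amp n k \<Phi> x) (amp m k \<Psi> x) (shuffle k n m i) (shuffle k n m j)
             else 0)"
  proof (cases "i < k * (n + m) \<and> j < k * (n + m)")
    case False
    have "0 < n + m" using assms(1) by simp
    then have "\<not> (i div (n + m) < k \<and> j div (n + m) < k)"
      using False by (simp only: div_less_iff_less_mult not_False_eq_True)
    then have "i div (n + m) \<ge> k \<or> j div (n + m) \<ge> k"
      by (simp only: not_less de_Morgan_conj)
    then have "amp (n + m) k (mat_dsum n \<Phi> \<Psi>) x i j = 0"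
      unfolding amp_apply using assms by (intro sum.neutral ballI) (simp add: \<Lambda>_unit_outside)
    then show ?thesis by (simp only: False if_False)
  next
    case True
    then have ij: "i < k * (n + m)" "j < k * (n + m)" by auto
    \<comment> \<open>The negated form of the first fact lets the simplifier settle on which side of
      \<open>k * n\<close> the shuffled index lies.\<close>
    note \<sigma>i = shuffle_left[OF assms(1) ij(1)] shuffle_left(1)[OF assms(1) ij(1), THEN not_le[THEN iffD2]]
      shuffle_right[OF assms(1) ij(1)]
    note \<sigma>j = shuffle_left[OF assms(1) ij(2)] shuffle_left(1)[OF assms(1) ij(2), THEN not_le[THEN iffD2]]
      shuffle_right[OF assms(1) ij(2)]
    have "amp (n + m) k (mat_dsum n \<Phi> \<Psi>) x i j
      = mat_dsum (k * n) (amp n k \<Phi> x) (amp m k \<Psi> x) (shuffle k n m i) (shuffle k n m j)"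
      by (cases "i mod (n + m) < n"; cases "j mod (n + m) < n")
        (simp_all add: \<sigma>i \<sigma>j amp_apply mat_dsum_def leD)
    then show ?thesis using True by simp
  qed
qed

section \<open>Norm axioms and Ruan's axioms for \<open>cbn\<close>\<close>

text \<open>(R2) of \<open>F\<close> at size \<open>k * n\<close>; the estimate is uniform in
  \<open>k\<close> because amplifying \<alpha> and \<beta> does not increase their norms.\<close>

lemma cbn_sandwich:
  assumes "n \<ge> 1" "m \<ge> 1" "\<Phi> \<in> mats lin_maps n n" "\<alpha> \<in> mats UNIV m n" "\<beta> \<in> mats UNIV n m"
  shows "cbn m (mat_sandwich map_scale n \<alpha> \<Phi> \<beta>)
    \<le> ennreal (cmat_norm m n \<alpha>) * cbn n \<Phi> * ennreal (cmat_norm n m \<beta>)"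
proof (rule cbn_leI)
  fix k x
  assume k: "k \<ge> 1" and x: "x \<in> mats (os_carrier E) k k" "os_norm E k x \<le> 1"
  let ?v = "amp n k \<Phi> x"
  have v: "?v \<in> mats (os_carrier F) (k * n) (k * n)" using amp_mats assms k x by blast
  have nn: "os_norm F (k * n) ?v \<ge> 0" by (rule F.norm_nonneg[OF _ v]) (use assms k in simp)
  have "os_norm F (k * m) (amp m k (mat_sandwich map_scale n \<alpha> \<Phi> \<beta>) x)
      \<le> cmat_norm (k * m) (k * n) (mat_ampl k m n \<alpha>) * os_norm F (k * n) ?v
        * cmat_norm (k * n) (k * m) (mat_ampl k n m \<beta>)"
    unfolding amp_sandwich[OF assms(1,2) k]
    by (rule F.ruan_R2[OF _ _ v mat_ampl_mats mat_ampl_mats]) (use assms k in simp_all)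
  also have "\<dots> \<le> cmat_norm m n \<alpha> * os_norm F (k * n) ?v * cmat_norm n m \<beta>"
    by (intro mult_mono cmat_norm_mat_ampl assms mult_nonneg_nonneg cmat_norm_nonneg nn order.refl)
  finally have "ennreal (os_norm F (k * m) (amp m k (mat_sandwich map_scale n \<alpha> \<Phi> \<beta>) x))
      \<le> ennreal (cmat_norm m n \<alpha>) * ennreal (os_norm F (k * n) ?v) * ennreal (cmat_norm n m \<beta>)"
    by (simp add: ennreal_mult'[symmetric] ennreal_mult''[symmetric] cmat_norm_nonneg nn ennreal_leI)
  also have "\<dots> \<le> ennreal (cmat_norm m n \<alpha>) * cbn n \<Phi> * ennreal (cmat_norm n m \<beta>)"
    by (intro mult_right_mono mult_left_mono cbn_upper k x) auto
  finally show "ennreal (os_norm F (k * m) (amp m k (mat_sandwich map_scale n \<alpha> \<Phi> \<beta>) x))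
      \<le> ennreal (cmat_norm m n \<alpha>) * cbn n \<Phi> * ennreal (cmat_norm n m \<beta>)" .
qed

text \<open>\<open>norm_permute_le\<close> removes the shuffle, after which (R1) of \<open>F\<close>
  applies at sizes \<open>k * n\<close> and \<open>k * m\<close>.\<close>

lemma cbn_dsum:
  assumes "n \<ge> 1" "m \<ge> 1" "\<Phi> \<in> mats lin_maps n n" "\<Psi> \<in> mats lin_maps m m"
  shows "cbn (n + m) (mat_dsum n \<Phi> \<Psi>) \<le> max (cbn n \<Phi>) (cbn m \<Psi>)"
proof (rule cbn_leI)
  fix k x
  assume k: "k \<ge> 1" and x: "x \<in> mats (os_carrier E) k k" "os_norm E k x \<le> 1"
  let ?v = "amp n k \<Phi> x" and ?w = "amp m k \<Psi> x"
  have v: "?v \<in> mats (os_carrier F) (k * n) (k * n)" and w: "?w \<in> mats (os_carrier F) (k * m) (k * m)"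
    using amp_mats assms k x by blast+
  have "mat_dsum (k * n) ?v ?w \<in> mats (os_carrier F) (k * (n + m)) (k * (n + m))"
    using F.mat_dsum_mats[OF v w] by (simp add: distrib_left)
  then have "os_norm F (k * (n + m)) (amp (n + m) k (mat_dsum n \<Phi> \<Psi>) x)
      \<le> os_norm F (k * (n + m)) (mat_dsum (k * n) ?v ?w)"
    unfolding amp_dsum[OF assms(1,2) k]
    by (intro F.norm_permute_le shuffle_bij assms) (use assms k in simp_all)
  also have "\<dots> \<le> max (os_norm F (k * n) ?v) (os_norm F (k * m) ?w)"
    unfolding distrib_left by (intro F.ruan_R1 v w) (use assms k in simp_all)
  finally have "ennreal (os_norm F (k * (n + m)) (amp (n + m) k (mat_dsum n \<Phi> \<Psi>) x))
      \<le> max (ennreal (os_norm F (k * n) ?v)) (ennreal (os_norm F (k * m) ?w))"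
    by (auto simp: max_def ennreal_leI split: if_splits) (meson ennreal_leI order.trans nle_le)+
  also have "\<dots> \<le> max (cbn n \<Phi>) (cbn m \<Psi>)"
    by (intro max.mono cbn_upper k x)
  finally show "ennreal (os_norm F (k * (n + m)) (amp (n + m) k (mat_dsum n \<Phi> \<Psi>) x))
      \<le> max (cbn n \<Phi>) (cbn m \<Psi>)" .
qed

lemma cbn_add:
  assumes "n \<ge> 1" "\<Phi> \<in> mats lin_maps n n" "\<Psi> \<in> mats lin_maps n n"
  shows "cbn n (\<Phi> + \<Psi>) \<le> cbn n \<Phi> + cbn n \<Psi>"
proof (rule cbn_leI)
  fix k x
  assume k: "k \<ge> 1" and x: "x \<in> mats (os_carrier E) k k" "os_norm E k x \<le> 1"
  let ?v = "amp n k \<Phi> x" and ?w = "amp n k \<Psi> x"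
  have v: "?v \<in> mats (os_carrier F) (k * n) (k * n)" and w: "?w \<in> mats (os_carrier F) (k * n) (k * n)"
    using amp_mats assms k x by blast+
  have kn: "k * n \<ge> 1" using assms k by simp
  have "ennreal (os_norm F (k * n) (amp n k (\<Phi> + \<Psi>) x))
      \<le> ennreal (os_norm F (k * n) ?v + os_norm F (k * n) ?w)"
    unfolding amp_add by (intro ennreal_leI F.norm_add v w kn)
  also have "\<dots> = ennreal (os_norm F (k * n) ?v) + ennreal (os_norm F (k * n) ?w)"
    using F.norm_nonneg[OF kn v] F.norm_nonneg[OF kn w] by simp
  also have "\<dots> \<le> cbn n \<Phi> + cbn n \<Psi>"
    by (intro add_mono cbn_upper k x)
  finally show "ennreal (os_norm F (k * n) (amp n k (\<Phi> + \<Psi>) x)) \<le> cbn n \<Phi> + cbn n \<Psi>" .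
qed

lemma cbn_scale_le:
  assumes "n \<ge> 1" "\<Phi> \<in> mats lin_maps n n"
  shows "cbn n (\<lambda>i j. map_scale c (\<Phi> i j)) \<le> ennreal (cmod c) * cbn n \<Phi>"
proof (rule cbn_leI)
  fix k x
  assume k: "k \<ge> 1" and x: "x \<in> mats (os_carrier E) k k" "os_norm E k x \<le> 1"
  have "os_norm F (k * n) (amp n k (\<lambda>i j. map_scale c (\<Phi> i j)) x) = cmod c * os_norm F (k * n) (amp n k \<Phi> x)"
    unfolding amp_scale by (rule F.norm_scale) (use amp_mats assms k x in auto)
  then show "ennreal (os_norm F (k * n) (amp n k (\<lambda>i j. map_scale c (\<Phi> i j)) x)) \<le> ennreal (cmod c) * cbn n \<Phi>"
    using cbn_upper[OF k x, of n \<Phi>] by (simp add: ennreal_mult' mult_left_mono)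
qed

text \<open>The reverse inequality is the upper bound for the scalar \<open>inverse c\<close>
  applied to the scaled matrix.\<close>

lemma cbn_scale:
  assumes "n \<ge> 1" "\<Phi> \<in> mats lin_maps n n"
  shows "cbn n (\<lambda>i j. map_scale c (\<Phi> i j)) = ennreal (cmod c) * cbn n \<Phi>"
proof (cases "c = 0")
  \<comment> \<open>Here the upper bound is already 0, even if \<open>cbn n \<Phi>\<close> is
    infinite, because 0 times infinity is 0 in \<open>ennreal\<close>.\<close>
  case True
  then show ?thesis using cbn_scale_le[OF assms, of c] by simp
next
  case False
  let ?c\<Phi> = "\<lambda>i j. map_scale c (\<Phi> i j)"
  have c\<Phi>: "?c\<Phi> \<in> mats lin_maps n n"
    using assms(2) maps.subspace_scale[OF lin_maps_subspace] by (auto simp: mats_def fun_eq_iff)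
  have "ennreal (cmod c) * cbn n \<Phi> \<le> ennreal (cmod c) * (ennreal (cmod (inverse c)) * cbn n ?c\<Phi>)"
    using cbn_scale_le[OF assms(1) c\<Phi>, of "inverse c"] False by (intro mult_left_mono) simp_all
  also have "\<dots> = cbn n ?c\<Phi>"
    using False by (simp add: mult.assoc[symmetric] ennreal_mult''[symmetric] norm_inverse)
  finally show ?thesis using cbn_scale_le[OF assms, of c] by (intro antisym)
qed

lemma cbn_zero: "n \<ge> 1 \<Longrightarrow> cbn n 0 = 0"
  using cbn_scale_le[of n 0 0] maps.subspace_0[OF lin_maps_subspace] by (simp add: mats_def zero_fun_def)

text \<open>Only \<open>k = 1\<close> is tested: on a multiple of \<open>e\<close> in the unit ball,
  each entry of the amplification is a non-zero scalar times the value of an entry of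
  \<Phi>.\<close>

lemma cbn_eq_0D:
  assumes "n \<ge> 1" "\<Phi> \<in> mats lin_maps n n" "cbn n \<Phi> = 0"
  shows "\<Phi> = 0"
proof -
  have "\<Phi> p q e = 0" if pq: "p < n" "q < n" and e: "e \<in> os_carrier E" for p q e
  proof -
    have \<Phi>_lin: "\<Phi> p q \<in> lin_maps" using assms(2) pq by (auto simp: mats_def)
    define x where "x = (\<lambda>(i::nat) (j::nat). if i = 0 \<and> j = 0 then e else 0)"
    have x: "x \<in> mats (os_carrier E) 1 1" using e by (auto simp: x_def mats_def)
    \<comment> \<open>Adding 1 in the denominator puts the scaled vector into the unit ball and
      keeps \<open>c\<close> defined and non-zero also for \<open>e = 0\<close>.\<close>
    define c where "c = complex_of_real (inverse (1 + os_norm E 1 x))"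
    have nx: "os_norm E 1 x \<ge> 0" using E.norm_nonneg[OF _ x] by simp
    then have c0: "c \<noteq> 0" by (simp add: c_def complex_eq_iff add_nonneg_eq_0_iff)
    let ?y = "\<lambda>i j. os_scale E c (x i j)"
    have y: "?y \<in> mats (os_carrier E) 1 1"
      using x E.subspace_scale[OF E.carrier_subspace] by (auto simp: mats_def)
    have "cmod c = inverse (1 + os_norm E 1 x)"
      unfolding c_def norm_of_real using nx by simp
    then have "os_norm E 1 ?y = inverse (1 + os_norm E 1 x) * os_norm E 1 x"
      using E.norm_scale[OF _ x] by simp
    also have "\<dots> \<le> 1" using nx by (simp add: field_simps)
    finally have ny: "os_norm E 1 ?y \<le> 1" .
    have a: "amp n 1 \<Phi> ?y \<in> mats (os_carrier F) n n"
      using amp_mats[OF assms(1) order.refl assms(2) y] by simp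
    have "ennreal (os_norm F n (amp n 1 \<Phi> ?y)) \<le> 0"
      using cbn_upper[OF order.refl y ny, of n \<Phi>] assms(3) by simp
    then have "amp n 1 \<Phi> ?y = 0"
      using F.norm_nonneg[OF assms(1) a] F.norm_eq_0[OF assms(1) a] by simp
    then have "amp n 1 \<Phi> ?y p q = 0" by simp
    then have "\<Phi> p q (os_scale E c e) = 0"
      using pq \<Lambda>_unit_nonzero by (simp add: amp_apply x_def)
    moreover have "\<Phi> p q (os_scale E c e) = os_scale F c (\<Phi> p q e)"
      using \<Phi>_lin e by (simp add: lin_maps_def linear_map_def)
    ultimately show ?thesis using c0 by simp
  qed
  \<comment> \<open>Outside the format or off the carrier the value is 0 by the conventions for
    matrices and maps.\<close>
  moreover have "\<Phi> p q e = 0" if "p \<ge> n \<or> q \<ge> n \<or> e \<notin> os_carrier E" for p q e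
    using assms(2) that by (cases "p < n \<and> q < n") (auto simp: mats_def lin_maps_def)
  ultimately show ?thesis
    unfolding fun_eq_iff zero_fun_apply by (meson not_le)
qed

section \<open>Finiteness is decided entry by entry\<close>

lemma single_mats: "\<phi> \<in> lin_maps \<Longrightarrow> (\<lambda>i j. if i = 0 \<and> j = 0 then \<phi> else 0) \<in> mats lin_maps 1 1"
  by (auto simp: mats_def)

lemma cbn_sandwich_finite:
  assumes "n \<ge> 1" "m \<ge> 1" "\<Phi> \<in> mats lin_maps n n" "\<alpha> \<in> mats UNIV m n" "\<beta> \<in> mats UNIV n m"
    and "cbn n \<Phi> < \<infinity>"
  shows "cbn m (mat_sandwich map_scale n \<alpha> \<Phi> \<beta>) < \<infinity>"
  by (rule order.strict_trans1[OF cbn_sandwich[OF assms(1-5)]])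
    (use assms(6) in \<open>simp add: ennreal_mult_less_top\<close>)

lemma lcb_norm_entry_finite:
  assumes "n \<ge> 1" "\<Phi> \<in> mats lin_maps n n" "cbn n \<Phi> < \<infinity>" "a < n" "b < n"
  shows "lcb_norm \<Lambda> E F (\<Phi> a b) < \<infinity>"
  using cbn_sandwich_finite[OF assms(1) order.refl assms(2) mat_unit_mats mat_unit_mats assms(3),
      of 0 a b 0] assms(4,5)
  by (simp add: mat_sandwich_unit[OF vector_space_map_scale] cbn_single del: One_nat_def)

lemma cbn_unit_entry_finite:
  assumes "n \<ge> 1" "a < n" "b < n" "\<phi> \<in> lcb_maps \<Lambda> E F"
  shows "cbn n (\<lambda>i j. if i = a \<and> j = b then \<phi> else 0) < \<infinity>"
  using cbn_sandwich_finite[OF order.refl assms(1) single_mats mat_unit_mats mat_unit_mats,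
      of \<phi> a 0 0 b] assms(2-4)
  by (simp add: mat_sandwich_unit[OF vector_space_map_scale] cbn_single lcb_maps_iff
      del: One_nat_def cong: if_cong)

text \<open>A matrix is the finite sum of its single-entry matrices, each of finite norm, and
  \<open>cbn_add\<close> sums the bounds.\<close>

lemma cbn_finite:
  assumes "n \<ge> 1" "\<Phi> \<in> mats (lcb_maps \<Lambda> E F) n n"
  shows "cbn n \<Phi> < \<infinity>"
proof -
  have entry: "\<Phi> i j \<in> lcb_maps \<Lambda> E F" if "i < n" "j < n" for i j
    using assms(2) that by (auto simp: mats_def)
  \<comment> \<open>Induction on the set \<open>S\<close> of positions kept, all other entries being
    replaced by 0.\<close>
  have "S \<subseteq> {..<n} \<times> {..<n} \<Longrightarrow> cbn n (\<lambda>i j. if (i, j) \<in> S then \<Phi> i j else 0) < \<infinity>"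
    if "finite S" for S
    using that
  proof (induction S)
    case empty
    then show ?case using cbn_zero[OF assms(1)] by (simp add: zero_fun_def)
  next
    case (insert ab S)
    obtain a b where ab: "ab = (a, b)" "a < n" "b < n" using insert.prems by (cases ab) auto
    let ?P = "\<lambda>i j. if i = a \<and> j = b then \<Phi> a b else 0"
    let ?R = "\<lambda>i j. if (i, j) \<in> S then \<Phi> i j else 0"
    let ?Q = "\<lambda>i j. if (i, j) \<in> insert ab S then \<Phi> i j else 0"
    have Q: "?Q = ?P + ?R"
      using insert.hyps(2) ab(1) by (intro ext) auto
    have P_lin: "?P \<in> mats lin_maps n n" and R_lin: "?R \<in> mats lin_maps n n"
      using entry ab insert.prems maps.subspace_0[OF lin_maps_subspace]
      by (auto simp: mats_def lcb_maps_iff)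
    have "cbn n ?Q \<le> cbn n ?P + cbn n ?R"
      unfolding Q by (rule cbn_add[OF assms(1) P_lin R_lin])
    also have "\<dots> < \<infinity>"
      using cbn_unit_entry_finite[OF assms(1) ab(2,3) entry[OF ab(2,3)]] insert.IH insert.prems
      by simp
    finally show ?case .
  qed
  from this[of "{..<n} \<times> {..<n}"]
  have "cbn n (\<lambda>i j. if i < n \<and> j < n then \<Phi> i j else 0) < \<infinity>" by simp
  moreover have "(\<lambda>i j. if i < n \<and> j < n then \<Phi> i j else 0) = \<Phi>"
    using assms(2) by (auto simp: mats_def fun_eq_iff)
  ultimately show ?thesis by simp
qed

lemma mats_lcb_maps_iff:
  assumes "n \<ge> 1"
  shows "\<Phi> \<in> mats (lcb_maps \<Lambda> E F) n n \<longleftrightarrow> \<Phi> \<in> mats lin_maps n n \<and> cbn n \<Phi> < \<infinity>"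
proof
  assume \<Phi>: "\<Phi> \<in> mats (lcb_maps \<Lambda> E F) n n"
  then have "\<Phi> \<in> mats lin_maps n n" by (auto simp: mats_def lcb_maps_iff)
  with cbn_finite[OF assms \<Phi>] show "\<Phi> \<in> mats lin_maps n n \<and> cbn n \<Phi> < \<infinity>" by simp
next
  assume "\<Phi> \<in> mats lin_maps n n \<and> cbn n \<Phi> < \<infinity>"
  then show "\<Phi> \<in> mats (lcb_maps \<Lambda> E F) n n"
    using lcb_norm_entry_finite[OF assms] by (auto simp: mats_def lcb_maps_iff)
qed

section \<open>The identification of matrices of maps with matrix-valued maps\<close>

text \<open>Linearity and vanishing off the carrier hold entrywise; finiteness passes between a
  matrix and its entries by \<open>mats_lcb_maps_iff\<close>.\<close>

lemma mat_of_maps_mem_iff: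
  assumes "n \<ge> 1"
  shows "mat_of_maps \<Phi> \<in> lcb_maps \<Lambda> E (mat_os n F) \<longleftrightarrow> \<Phi> \<in> mats (lcb_maps \<Lambda> E F) n n"
proof -
  have "linear_map E (mat_os n F) (mat_of_maps \<Phi>) \<and> (\<forall>x. x \<notin> os_carrier E \<longrightarrow> mat_of_maps \<Phi> x = 0)
      \<longleftrightarrow> \<Phi> \<in> mats lin_maps n n" (is "?L \<longleftrightarrow> ?R")
  proof
    assume L: ?L
    have "\<Phi> i j e = 0" if "i \<ge> n \<or> j \<ge> n" for i j e
      using L that
      by (cases "e \<in> os_carrier E") (auto simp: linear_map_def mat_os_def mats_def mat_of_maps_def fun_eq_iff)
    then show ?R
      using L by (auto simp: linear_map_def mat_os_def mats_def mat_of_maps_def fun_eq_iff lin_maps_def)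
  next
    assume R: ?R
    have zero: "\<Phi> i j = 0" if "\<not> (i < n \<and> j < n)" for i j
      using R that by (auto simp: mats_def not_less)
    have lin: "\<Phi> i j \<in> lin_maps" for i j
      using R zero[of i j] maps.subspace_0[OF lin_maps_subspace]
      by (cases "i < n \<and> j < n") (auto simp: mats_def)
    show ?L
      using lin zero
      by (auto simp: linear_map_def mat_os_def mats_def mat_of_maps_def fun_eq_iff lin_maps_def)
  qed
  then show ?thesis
    using mats_lcb_maps_iff[OF assms] by (auto simp: lcb_maps_def)
qed

text \<open>Closure under sums and multiples comes from \<open>cbn_add\<close> and
  \<open>cbn_scale\<close> for 1 by 1 matrices.\<close>

lemma lcb_maps_subspace: "maps.subspace (lcb_maps \<Lambda> E F)"
proof (rule maps.subspaceI)
  let ?S = "\<lambda>\<phi> i j. if i = 0 \<and> j = (0::nat) then \<phi> else (0::'e \<Rightarrow> 'f)"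
  show "0 \<in> lcb_maps \<Lambda> E F"
    using cbn_single[of 0] cbn_zero[of 1] maps.subspace_0[OF lin_maps_subspace]
    by (simp add: lcb_maps_iff zero_fun_def del: One_nat_def)
  fix \<phi> assume \<phi>: "\<phi> \<in> lcb_maps \<Lambda> E F"
  {
    fix \<psi> assume \<psi>: "\<psi> \<in> lcb_maps \<Lambda> E F"
    have S: "?S (\<phi> + \<psi>) = ?S \<phi> + ?S \<psi>" by (auto simp: fun_eq_iff)
    have "lcb_norm \<Lambda> E F (\<phi> + \<psi>) \<le> lcb_norm \<Lambda> E F \<phi> + lcb_norm \<Lambda> E F \<psi>"
      unfolding cbn_single[symmetric] S
      by (intro cbn_add order.refl single_mats) (use \<phi> \<psi> in \<open>simp_all add: lcb_maps_iff\<close>)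
    also have "\<dots> < \<infinity>" using \<phi> \<psi> by (simp add: lcb_maps_iff)
    finally show "\<phi> + \<psi> \<in> lcb_maps \<Lambda> E F"
      using \<phi> \<psi> maps.subspace_add[OF lin_maps_subspace] by (simp add: lcb_maps_iff)
  next
    fix c
    have S: "?S (map_scale c \<phi>) = (\<lambda>i j. map_scale c (?S \<phi> i j))" by (auto simp: fun_eq_iff)
    have "lcb_norm \<Lambda> E F (map_scale c \<phi>) = ennreal (cmod c) * lcb_norm \<Lambda> E F \<phi>"
      unfolding cbn_single[symmetric] S
      by (intro cbn_scale order.refl single_mats) (use \<phi> in \<open>simp add: lcb_maps_iff\<close>)
    also have "\<dots> < \<infinity>" using \<phi> by (simp add: lcb_maps_iff ennreal_mult_less_top)
    finally show "map_scale c \<phi> \<in> lcb_maps \<Lambda> E F"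
      using \<phi> maps.subspace_scale[OF lin_maps_subspace] by (simp add: lcb_maps_iff)
  }
qed

section \<open>The operator space of maps\<close>

lemma CB_os_simps:
  "os_carrier (CB_os \<Lambda> E F) = lcb_maps \<Lambda> E F"
  "os_scale (CB_os \<Lambda> E F) = map_scale"
  "os_norm (CB_os \<Lambda> E F) n \<Phi> = enn2real (cbn n \<Phi>)"
  by (simp_all add: CB_os_def)

lemma operator_space_CB_os: "operator_space (CB_os \<Lambda> E F)"
proof (intro operator_space.intro operator_space_axioms.intro, unfold CB_os_simps)
  show "vector_space map_scale" by (rule vector_space_map_scale)
  show "maps.subspace (lcb_maps \<Lambda> E F)" by (rule lcb_maps_subspace)
next
  fix n :: nat and v assume n: "n \<ge> 1" and v: "v \<in> mats (lcb_maps \<Lambda> E F) n n"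
  \<comment> \<open>\<open>enn2real\<close> is monotone only below infinity and sends infinity to 0,
    so definiteness and the inequalities rest on finite values.\<close>
  have v_lin: "v \<in> mats lin_maps n n" and v_fin: "cbn n v < \<infinity>"
    using v mats_lcb_maps_iff[OF n] by blast+
  show "enn2real (cbn n v) \<ge> 0" by simp
  show "enn2real (cbn n v) = 0 \<longleftrightarrow> v = 0"
    using v_fin cbn_eq_0D[OF n v_lin] cbn_zero[OF n] by (auto simp: enn2real_eq_0_iff)
  show "enn2real (cbn n (\<lambda>i j. map_scale c (v i j))) = cmod c * enn2real (cbn n v)" for c
    by (simp add: cbn_scale[OF n v_lin] enn2real_mult)
  show "enn2real (cbn n (v + w)) \<le> enn2real (cbn n v) + enn2real (cbn n w)"
    if "w \<in> mats (lcb_maps \<Lambda> E F) n n" for w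
  proof -
    have w: "w \<in> mats lin_maps n n" "cbn n w < \<infinity>"
      using that mats_lcb_maps_iff[OF n] by blast+
    have "enn2real (cbn n (v + w)) \<le> enn2real (cbn n v + cbn n w)"
      by (rule enn2real_mono[OF cbn_add[OF n v_lin w(1)]]) (use v_fin w(2) in simp)
    then show ?thesis using v_fin w(2) by (simp add: enn2real_plus)
  qed
  fix m :: nat assume m: "m \<ge> 1"
  show "enn2real (cbn (n + m) (mat_dsum n v w)) \<le> max (enn2real (cbn n v)) (enn2real (cbn m w))"
    if "w \<in> mats (lcb_maps \<Lambda> E F) m m" for w
  proof -
    have w: "w \<in> mats lin_maps m m" "cbn m w < \<infinity>"
      using that mats_lcb_maps_iff[OF m] by blast+
    have "enn2real (cbn (n + m) (mat_dsum n v w)) \<le> enn2real (max (cbn n v) (cbn m w))"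
      by (rule enn2real_mono[OF cbn_dsum[OF n m v_lin w(1)]]) (use v_fin w(2) in simp)
    also have "\<dots> \<le> max (enn2real (cbn n v)) (enn2real (cbn m w))"
      by (simp add: max_def)
    finally show ?thesis .
  qed
  show "enn2real (cbn m (mat_sandwich map_scale n \<alpha> v \<beta>))
      \<le> cmat_norm m n \<alpha> * enn2real (cbn n v) * cmat_norm n m \<beta>"
    if "\<alpha> \<in> mats UNIV m n" "\<beta> \<in> mats UNIV n m" for \<alpha> \<beta>
  proof -
    have "enn2real (cbn m (mat_sandwich map_scale n \<alpha> v \<beta>))
        \<le> enn2real (ennreal (cmat_norm m n \<alpha>) * cbn n v * ennreal (cmat_norm n m \<beta>))"
      by (rule enn2real_mono[OF cbn_sandwich[OF n m v_lin that]])
        (use v_fin in \<open>simp add: ennreal_mult_less_top\<close>)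
    then show ?thesis by (simp add: enn2real_mult cmat_norm_nonneg)
  qed
qed

lemma linear_map_mat_of_maps:
  assumes "n \<ge> 1"
  shows "linear_map (mat_os n (CB_os \<Lambda> E F)) (CB_os \<Lambda> E (mat_os n F)) mat_of_maps"
  using mat_of_maps_mem_iff[OF assms]
  by (auto simp: linear_map_def mat_os_def CB_os_def mat_of_maps_def fun_eq_iff)

lemma bij_betw_mat_of_maps:
  assumes "n \<ge> 1"
  shows "bij_betw mat_of_maps (mats (lcb_maps \<Lambda> E F) n n) (lcb_maps \<Lambda> E (mat_os n F))"
proof (rule bij_betw_byWitness[where f' = "\<lambda>\<psi> i j e. \<psi> e i j"])
  have "\<psi> = mat_of_maps (\<lambda>i j e. \<psi> e i j)" for \<psi> :: "'e \<Rightarrow> nat \<Rightarrow> nat \<Rightarrow> 'f"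
    by (simp add: mat_of_maps_def)
  then show "(\<lambda>\<psi> i j e. \<psi> e i j) ` lcb_maps \<Lambda> E (mat_os n F) \<subseteq> mats (lcb_maps \<Lambda> E F) n n"
    using mat_of_maps_mem_iff[OF assms] by auto
qed (use mat_of_maps_mem_iff[OF assms] in \<open>auto simp: mat_of_maps_def\<close>)

end

theorem theorem2p4:
  fixes E :: "'e::ab_group_add os" and F :: "'f::ab_group_add os"
    and \<Lambda> :: "nat \<Rightarrow> (nat \<Rightarrow> nat \<Rightarrow> complex) \<Rightarrow> nat \<Rightarrow> nat \<Rightarrow> complex"
  assumes "operator_space E" and "operator_space F"
    and "\<And>n. n \<ge> 1 \<Longrightarrow> linear_map (mat_os n complex_os) (mat_os n complex_os) (\<Lambda> n)"
    and "\<And>n. n \<ge> 1 \<Longrightarrow> \<exists>A \<in> mats UNIV n n. \<Lambda> n A \<noteq> 0"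
    and "(SUP n\<in>{1..}. op_norm (mats UNIV n n) (cmat_norm n n) (cmat_norm n n) (\<Lambda> n)) < \<infinity>"
  shows "operator_space (CB_os \<Lambda> E F)
    \<and> (\<forall>n\<ge>1. linear_map (mat_os n (CB_os \<Lambda> E F)) (CB_os \<Lambda> E (mat_os n F)) mat_of_maps
            \<and> bij_betw mat_of_maps (mats (lcb_maps \<Lambda> E F) n n) (lcb_maps \<Lambda> E (mat_os n F))
            \<and> (\<forall>\<Phi> \<in> mats (lcb_maps \<Lambda> E F) n n.
                 ennreal (os_norm (CB_os \<Lambda> E F) n \<Phi>) = lcb_norm \<Lambda> E (mat_os n F) (mat_of_maps \<Phi>)))
    \<and> (\<forall>\<phi> \<in> lcb_maps \<Lambda> E F.
          ennreal (os_norm (CB_os \<Lambda> E F) 1 (\<lambda>i j. if i = 0 \<and> j = 0 then \<phi> else 0)) = lcb_norm \<Lambda> E F \<phi>)"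
proof -
  interpret lcb_setting E F \<Lambda>
    using assms(1-3) assms(4)[of 1] by (intro lcb_setting.intro lcb_setting_axioms.intro) auto
  \<comment> \<open>The norm is finite, so passing to a real number and back loses nothing.\<close>
  have "ennreal (os_norm (CB_os \<Lambda> E F) n \<Phi>) = lcb_norm \<Lambda> E (mat_os n F) (mat_of_maps \<Phi>)"
    if "n \<ge> 1" "\<Phi> \<in> mats (lcb_maps \<Lambda> E F) n n" for n \<Phi>
    using cbn_finite[OF that] by (simp add: CB_os_simps)
  moreover have "ennreal (os_norm (CB_os \<Lambda> E F) 1 (\<lambda>i j. if i = 0 \<and> j = 0 then \<phi> else 0)) = lcb_norm \<Lambda> E F \<phi>"
    if "\<phi> \<in> lcb_maps \<Lambda> E F" for \<phi>
    using that by (simp add: CB_os_simps cbn_single lcb_maps_iff del: One_nat_def)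
  ultimately show ?thesis
    using operator_space_CB_os linear_map_mat_of_maps bij_betw_mat_of_maps by blast
qed

end
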